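(* Let $\{\mathbf x^{(k)}\}$ be the sequence generated by Algorithm ACQUIRE (described in the context) applied to the problem of minimizing $F$ over $\mathcal S$. Then there exists a subsequence $\{\mathbf x^{(k_j)}\}$ such that $$\lim_{k_j\to\infty}\mathbf x^{(k_j)}=\overline{\mathbf x},$$ where $\overline{\mathbf x}\in\mathcal S$ satisfies $\nabla_{\mathcal S}F(\overline{\mathbf x})=\mathbf 0$. Furthermore, any limit point $\widetilde{\mathbf x}$ of $\{\mathbf x^{(k)}\}$ satisfies $\nabla_{\mathcal S}F(\widetilde{\mathbf x})=\mathbf 0$.
   Context: Data. $m,n\in\mathbb N$ with $n=rs$; $A=(a_{ij})\in\mathbb R^{m\times n}$ with $a_{ij}\ge 0$ for all $i,j$ and $\sum_{i=1}^m a_{ij}=1$ for all $j$; $\mathbf b\in\mathbb R^m$ with $\mathbf b>0$ componentwise; $\mathbf y\in\mathbb R^m$ with $\mathbf y\ge 0$; $\lambda>0$, $\mu>0$; $\mathcal S$ is a nonempty, closed, convex subset of $\mathbb R^n_+=\{\mathbf x\in\mathbb R^n:\mathbf x\ge 0\}$. $\|\cdot\|$ is the Euclidean norm. Objective. Define $$D_{KL}(\mathbf x)=\sum_{j=1}^m\Big(y_j\ln\frac{y_j}{(A\mathbf x+\mathbf b)_j}+(A\mathbf x+\mathbf b)_j-y_j\Big),$$ where the term $y_j\ln(y_j/(A\mathbf x+\mathbf b)_j)$ is $0$ if $y_j=0$; this formula is used on the open set $\{\mathbf x: A\mathbf x+\mathbf b>0\}\supset\mathbb R^n_+$, so gradients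 and Hessians make sense at points of $\mathbb R^n_+$. A vector $\mathbf x\in\mathbb R^n$ is identified with an image $X\in\mathbb R^{r\times s}$ by $x_i=X_{k,l}$, $i=(l-1)r+k$, and $D_i\in\mathbb R^{2\times n}$ is the fixed matrix with $D_i\mathbf x=(X_{k+1,l}-X_{k,l},\;X_{k,l+1}-X_{k,l})^T$, where out-of-range entries of $X$ are given by fixed linear homogeneous boundary conditions (e.g. periodic). Let $$TV_\mu(\mathbf x)=\sum_{i=1}^n\phi_\mu(\|D_i\mathbf x\|),\qquad \phi_\mu(z)=\begin{cases}|z| & |z|>\mu,\\ \tfrac12\big(\tfrac{z^2}{\mu}+\mu\big)&\text{otherwise},\end{cases}$$ and $F(\mathbf x)=D_{KL}(\mathbf x)+\lambda\,TV_\mu(\mathbf x)$. Projected gradient. For a function $f$ continuously differentiable on an open set containing $\mathcal S$ and $\mathbf x\in\mathcal S$, $\nabla_{\mathcal S}f(\mathbf x)=\arg\min\{\|\mathbf v+\nabla f(\mathbf x)\| : \mathbf v\in T_{\mathcal S}(\mathbf x)\}$, i.e. the orthogonal projection of $-\nabla f(\mathbf x)$ onto the tangent cone $T_{\mathcal S}(\mathbf x)$ to $\mathcal S$ at $\mathbf x$ (the closure of $\{t(\mathbf z-\mathbf x):\mathbf z\in\mathcal S,\ t\ge0\}$). Quadratic models. Fix $\gamma>0$ (the choice $\gamma=0$ is also allowed when $\mathbf y>0$, $A$ has trivial nullspace and $\mathcal S$ is bounded). Given $\mathbf x^{(k)}\in\mathcal S$, put $$D^{(k)}_{KL}(\mathbf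 x)=D_{KL}(\mathbf x^{(k)})+(\mathbf x-\mathbf x^{(k)})^T\nabla D_{KL}(\mathbf x^{(k)})+\tfrac12(\mathbf x-\mathbf x^{(k)})^T\big(\nabla^2D_{KL}(\mathbf x^{(k)})+\gamma I\big)(\mathbf x-\mathbf x^{(k)}),$$ $$TV^{(k)}_\mu(\mathbf x)=\tfrac12\sum_{i=1}^n w^{(k)}_i\|D_i\mathbf x\|^2+\tfrac12TV_\mu(\mathbf x^{(k)}),\qquad w^{(k)}_i=\begin{cases}\|D_i\mathbf x^{(k)}\|^{-1}&\|D_i\mathbf x^{(k)}\|>\mu,\\ \mu^{-1}&\text{otherwise},\end{cases}$$ and $F_k=D^{(k)}_{KL}+\lambda\,TV^{(k)}_\mu$. Let $\overline{\mathbf x}^{(k)}$ be the unique minimizer of $F_k$ over $\mathcal S$. Algorithm ACQUIRE. Choose $\mathbf x^{(0)}\in\mathcal S$, $\eta\in(0,1)$, $\delta\in(0,1)$ and $\{\varepsilon_k\}$ with $\varepsilon_k>0$, $\lim_{k\to\infty}\varepsilon_k=0$. For $k=0,1,2,\dots$: (1) compute any $\widehat{\mathbf x}^{(k)}\in\mathcal S$ with $\|\widehat{\mathbf x}^{(k)}-\overline{\mathbf x}^{(k)}\|\le\varepsilon_k$ and $F_k(\widehat{\mathbf x}^{(k)})\le F_k(\mathbf x^{(k)})$; (2) set $\mathbf d^{(k)}=\widehat{\mathbf x}^{(k)}-\mathbf x^{(k)}$ and let $\alpha_k$ be the first element of $1,\delta,\delta^2,\dots$ such that $F(\mathbf x^{(k)}+\alpha_k\mathbf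 d^{(k)})\le F(\mathbf x^{(k)})+\eta\,\alpha_k\nabla F(\mathbf x^{(k)})^T\mathbf d^{(k)}$; (3) set $\mathbf x^{(k+1)}=\mathbf x^{(k)}+\alpha_k\mathbf d^{(k)}$. *)

theory Defs
  imports "HOL-Analysis.Analysis"
begin

definition gradient :: "('a::real_inner \<Rightarrow> real) \<Rightarrow> 'a \<Rightarrow> 'a" where
  "gradient f x = (THE g. GDERIV f x :> g)"

lemma gradient_eqI:
  assumes "GDERIV f x :> g"
  shows "gradient f x = g"
  unfolding gradient_def
proof (rule the_equality)
  show "GDERIV f x :> g" by (fact assms)
next
  fix h assume "GDERIV f x :> h"
  with assms have "(\<lambda>u. u \<bullet> g) = (\<lambda>u. u \<bullet> h)"
    unfolding gderiv_def by (rule has_derivative_unique)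
  then have "\<forall>u. u \<bullet> h = u \<bullet> g" by (metis (mono_tags))
  then show "h = g" by (simp add: vector_eq_ldot)
qed

definition hessian :: "(real^'n \<Rightarrow> real) \<Rightarrow> real^'n \<Rightarrow> real^'n^'n" where
  "hessian f x = jacobian (gradient f) (at x)"

definition tangent_cone :: "'a::real_normed_vector set \<Rightarrow> 'a \<Rightarrow> 'a set" where
  "tangent_cone S x = closure {t *\<^sub>R (z - x) | t z. z \<in> S \<and> t \<ge> 0}"

definition projected_gradient :: "'a::real_inner set \<Rightarrow> ('a \<Rightarrow> real) \<Rightarrow> 'a \<Rightarrow> 'a" where
  "projected_gradient S f x = arg_min_on (\<lambda>v. norm (v + gradient f x)) (tangent_cone S x)"

text \<open>
  A vector in \<open>real^'n\<close> is read as an \<open>r \<times> s\<close> image by column stacking. The labelling \<open>idx\<close>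
  is a bijection from the index type \<open>'n\<close> onto \<open>{1..r * s}\<close>, and pixel \<open>(k, l)\<close> is the coordinate
  labelled \<open>(l - 1) * r + k\<close>. Entries outside the image are given by the boundary condition:
  \<open>bc k l\<close> is the linear functional that produces the out-of-range entry \<open>(k, l)\<close>; its values at
  in-range positions are irrelevant.
\<close>

definition pixel ::
  "nat \<Rightarrow> nat \<Rightarrow> ('n \<Rightarrow> nat) \<Rightarrow> (nat \<Rightarrow> nat \<Rightarrow> real^'n \<Rightarrow> real) \<Rightarrow> real^'n \<Rightarrow> nat \<Rightarrow> nat \<Rightarrow> real" where
  "pixel r s idx bc x k l =
     (if k \<in> {1..r} \<and> l \<in> {1..s} then x $ (inv idx ((l - 1) * r + k)) else bc k l x)"

definition row_of :: "nat \<Rightarrow> nat \<Rightarrow> nat" where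
  "row_of r p = (p - 1) mod r + 1"

definition col_of :: "nat \<Rightarrow> nat \<Rightarrow> nat" where
  "col_of r p = (p - 1) div r + 1"

definition diff_vec ::
  "nat \<Rightarrow> nat \<Rightarrow> ('n \<Rightarrow> nat) \<Rightarrow> (nat \<Rightarrow> nat \<Rightarrow> real^'n \<Rightarrow> real) \<Rightarrow> 'n \<Rightarrow> real^'n \<Rightarrow> real^2" where
  "diff_vec r s idx bc i x =
     (let k = row_of r (idx i); l = col_of r (idx i); X = pixel r s idx bc x
      in vector [X (k + 1) l - X k l, X k (l + 1) - X k l])"

definition diff_matrix ::
  "nat \<Rightarrow> nat \<Rightarrow> ('n \<Rightarrow> nat) \<Rightarrow> (nat \<Rightarrow> nat \<Rightarrow> real^'n \<Rightarrow> real) \<Rightarrow> 'n \<Rightarrow> real^'n^2" where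
  "diff_matrix r s idx bc i = matrix (diff_vec r s idx bc i)"

lemma pixel_row_col:
  fixes idx :: "'n::finite \<Rightarrow> nat"
  assumes "bij_betw idx UNIV {1..r * s}"
  shows "row_of r (idx i) \<in> {1..r}" "col_of r (idx i) \<in> {1..s}"
    and "pixel r s idx bc x (row_of r (idx i)) (col_of r (idx i)) = x $ i"
proof -
  have "idx i \<in> {1..r * s}" using assms by (auto simp: bij_betw_def)
  then have i: "1 \<le> idx i" "idx i \<le> r * s" by auto
  then have r: "r > 0" by (cases "r = 0") auto
  show 1: "row_of r (idx i) \<in> {1..r}"
    using r by (auto simp: row_of_def Suc_le_eq)
  have "idx i - 1 < s * r" using i by (simp add: mult.commute)
  then have "(idx i - 1) div r < s" by (rule less_mult_imp_div_less)
  then show 2: "col_of r (idx i) \<in> {1..s}"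
    by (auto simp: col_of_def)
  have "(idx i - 1) div r * r + ((idx i - 1) mod r + 1) = idx i"
    using i div_mult_mod_eq[of "idx i - 1" r] by simp
  then have "(col_of r (idx i) - 1) * r + row_of r (idx i) = idx i"
    by (simp add: row_of_def col_of_def)
  moreover have "inj idx" using assms by (simp add: bij_betw_def)
  ultimately show "pixel r s idx bc x (row_of r (idx i)) (col_of r (idx i)) = x $ i"
    using 1 2 unfolding pixel_def by (simp add: inv_f_f)
qed

lemma diff_matrix_mult:
  fixes x :: "real^'n"
  assumes "\<And>k l. linear (bc k l)"
  shows "diff_matrix r s idx bc i *v x = diff_vec r s idx bc i x"
proof -
  have lin: "linear (\<lambda>x. pixel r s idx bc x k l)" for k l
  proof (cases "k \<in> {1..r} \<and> l \<in> {1..s}")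
    case True
    then show ?thesis unfolding pixel_def
      by (simp add: bounded_linear.linear bounded_linear_vec_nth)
  next
    case False
    then have "(\<lambda>x. pixel r s idx bc x k l) = bc k l" unfolding pixel_def by auto
    then show ?thesis using assms by simp
  qed
  have "linear (diff_vec r s idx bc i)"
    by (rule linearI)
      (auto simp: diff_vec_def Let_def vec_eq_iff forall_2 linear_add[OF lin]
        linear_scale[OF lin] algebra_simps)
  then show ?thesis unfolding diff_matrix_def by (simp add: matrix_works)
qed

text \<open>
  The formula is meaningful on the open set where \<open>A *v x + b\<close> is componentwise positive; at other
  points the value is an artefact of the totality of \<open>ln\<close> and division.
\<close>

definition D_KL :: "real^'n^'m \<Rightarrow> real^'m \<Rightarrow> real^'m \<Rightarrow> real^'n \<Rightarrow> real" where
  "D_KL A b y x =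
     (\<Sum>j\<in>UNIV. (if y $ j = 0 then 0 else y $ j * ln (y $ j / (A *v x + b) $ j))
               + (A *v x + b) $ j - y $ j)"

definition huber :: "real \<Rightarrow> real \<Rightarrow> real" where
  "huber \<mu> z = (if \<bar>z\<bar> > \<mu> then \<bar>z\<bar> else (1/2) * (z\<^sup>2 / \<mu> + \<mu>))"

definition TV :: "('n \<Rightarrow> real^'n^2) \<Rightarrow> real \<Rightarrow> real^'n \<Rightarrow> real" where
  "TV D \<mu> x = (\<Sum>i\<in>UNIV. huber \<mu> (norm (D i *v x)))"

definition objective ::
  "real^'n^'m \<Rightarrow> real^'m \<Rightarrow> real^'m \<Rightarrow> ('n \<Rightarrow> real^'n^2) \<Rightarrow> real \<Rightarrow> real \<Rightarrow> real^'n \<Rightarrow> real" where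
  "objective A b y D lam \<mu> x = D_KL A b y x + lam * TV D \<mu> x"

text \<open>In the following the argument \<open>u\<close> is the current iterate, at which the model is built.\<close>

definition D_KL_model ::
  "real^'n^'m \<Rightarrow> real^'m \<Rightarrow> real^'m \<Rightarrow> real \<Rightarrow> real^'n \<Rightarrow> real^'n \<Rightarrow> real" where
  "D_KL_model A b y \<gamma> u x =
     D_KL A b y u + (x - u) \<bullet> gradient (D_KL A b y) u
     + (1/2) * ((x - u) \<bullet> ((hessian (D_KL A b y) u + \<gamma> *\<^sub>R mat 1) *v (x - u)))"

definition TV_weight :: "('n \<Rightarrow> real^'n^2) \<Rightarrow> real \<Rightarrow> real^'n \<Rightarrow> 'n \<Rightarrow> real" where
  "TV_weight D \<mu> u i =
     (if norm (D i *v u) > \<mu> then inverse (norm (D i *v u)) else inverse \<mu>)"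

definition TV_model :: "('n \<Rightarrow> real^'n^2) \<Rightarrow> real \<Rightarrow> real^'n \<Rightarrow> real^'n \<Rightarrow> real" where
  "TV_model D \<mu> u x =
     (1/2) * (\<Sum>i\<in>UNIV. TV_weight D \<mu> u i * (norm (D i *v x))\<^sup>2) + (1/2) * TV D \<mu> u"

definition model ::
  "real^'n^'m \<Rightarrow> real^'m \<Rightarrow> real^'m \<Rightarrow> ('n \<Rightarrow> real^'n^2) \<Rightarrow> real \<Rightarrow> real \<Rightarrow> real
    \<Rightarrow> real^'n \<Rightarrow> real^'n \<Rightarrow> real" where
  "model A b y D lam \<mu> \<gamma> u x = D_KL_model A b y \<gamma> u x + lam * TV_model D \<mu> u x"

definition armijo :: "('a::real_inner \<Rightarrow> real) \<Rightarrow> real \<Rightarrow> 'a \<Rightarrow> 'a \<Rightarrow> real \<Rightarrow> bool" where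
  "armijo F \<eta> x d \<alpha> \<longleftrightarrow> F (x + \<alpha> *\<^sub>R d) \<le> F x + \<eta> * \<alpha> * (gradient F x \<bullet> d)"

definition line_search :: "('a::real_inner \<Rightarrow> real) \<Rightarrow> real \<Rightarrow> real \<Rightarrow> 'a \<Rightarrow> 'a \<Rightarrow> real" where
  "line_search F \<eta> \<delta> x d = \<delta> ^ (LEAST p. armijo F \<eta> x d (\<delta> ^ p))"

text \<open>
  \<open>Fk u\<close> is the model built at the iterate \<open>u\<close>. The inexact minimizer \<open>xhat\<close> may be any point that
  passes the two tests, so a sequence generated by the algorithm is described by a predicate and
  not by a function.
\<close>

definition acquire_sequence ::
  "('a::real_inner \<Rightarrow> real) \<Rightarrow> ('a \<Rightarrow> 'a \<Rightarrow> real) \<Rightarrow> 'a set \<Rightarrow> real \<Rightarrow> real \<Rightarrow> (nat \<Rightarrow> real)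
    \<Rightarrow> (nat \<Rightarrow> 'a) \<Rightarrow> bool" where
  "acquire_sequence F Fk S \<eta> \<delta> \<epsilon> x \<longleftrightarrow>
     x 0 \<in> S \<and>
     (\<forall>k. \<exists>xhat\<in>S.
        norm (xhat - arg_min_on (Fk (x k)) S) \<le> \<epsilon> k \<and>
        Fk (x k) xhat \<le> Fk (x k) (x k) \<and>
        (let d = xhat - x k in x (Suc k) = x k + line_search F \<eta> \<delta> (x k) d *\<^sub>R d))"

end

theory Submission
  imports Defs
begin

text \<open>
  The model built at \<open>u\<close> has the gradient of \<open>F\<close> at \<open>u\<close> and curvature between two positive constants
  \<open>c\<close> and \<open>M\<close> that do not depend on \<open>u \<in> S\<close>. A step \<open>d\<close> that does not increase the model therefore
  has slope at most \<open>- c * \<parallel>d\<parallel>\<^sup>2 / 2\<close>. As \<open>F\<close> has a quadratic majorant on \<open>S\<close>, the line search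
  accepts step lengths bounded away from \<open>0\<close>, and \<open>F\<close> decreases by a multiple of \<open>\<parallel>d\<parallel>\<^sup>2\<close>. Since
  \<open>F\<close> is bounded below, \<open>d \<longlonglongrightarrow> 0\<close>, so the exact minimizers of the models approach
  the iterates. Comparing the model at its minimizer with its value at \<open>u + t (z - u)\<close>, passing to the
  limit along a subsequence and then letting \<open>t \<rightarrow> 0\<close> gives the variational inequality at any limit point.
  Coercivity of the Kullback-Leibler term on the orthant keeps the iterates bounded.
\<close>

section \<open>Line search along minimizers of quadratic models\<close>

text \<open>\<open>arg_min_on\<close> is a choice operator, so it says nothing until a minimizer
  exists. Compactness gives one on a ball around \<open>u\<close>, and \<open>out\<close> excludes
  better points outside it.\<close>

lemma is_arg_min_arg_min_on:
  fixes f :: "'a::euclidean_space \<Rightarrow> real"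
  assumes "closed S" "u \<in> S" "continuous_on S f"
    and out: "\<And>v. v \<in> S \<Longrightarrow> norm (v - u) > R \<Longrightarrow> f v \<ge> f u"
  shows "arg_min_on f S \<in> S" "\<And>v. v \<in> S \<Longrightarrow> f (arg_min_on f S) \<le> f v"
proof -
  \<comment> \<open>The absolute value keeps \<open>u\<close> in the ball even when \<open>R\<close>
    is negative.\<close>
  let ?T = "S \<inter> cball u \<bar>R\<bar>"
  have "compact ?T" "u \<in> ?T" "continuous_on ?T f"
    using assms by (auto simp: closed_Int_compact intro: continuous_on_subset)
  then obtain p where p: "p \<in> ?T" "\<And>v. v \<in> ?T \<Longrightarrow> f p \<le> f v"
    using continuous_attains_inf[of ?T f] by blast
  have "f p \<le> f v" if "v \<in> S" for v
  proof (cases "v \<in> ?T")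
    case False
    then have "f u \<le> f v" using out that by (auto simp: dist_norm norm_minus_commute)
    then show ?thesis using p(2)[OF \<open>u \<in> ?T\<close>] by simp
  qed (use p in auto)
  then have "is_arg_min f (\<lambda>v. v \<in> S) p" using p(1) by (auto simp: is_arg_min_linorder)
  then have "is_arg_min f (\<lambda>v. v \<in> S) (arg_min_on f S)"
    unfolding arg_min_on_def arg_min_def by (rule someI)
  then show "arg_min_on f S \<in> S" "\<And>v. v \<in> S \<Longrightarrow> f (arg_min_on f S) \<le> f v"
    by (auto simp: is_arg_min_linorder)
qed

text \<open>The half-space of the variational inequality is closed, so it contains the whole tangent
  cone. There the cross term of the squared norm is nonnegative, which makes 0 the only minimizer
  and hence the chosen one.\<close>

lemma projected_gradient_eq_0:
  fixes f :: "'a::real_inner \<Rightarrow> real"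
  assumes "x \<in> S" and var: "\<And>z. z \<in> S \<Longrightarrow> gradient f x \<bullet> (z - x) \<ge> 0"
  shows "projected_gradient S f x = 0"
proof -
  let ?g = "gradient f x" and ?T = "tangent_cone S x"
  have "?T \<subseteq> {v. ?g \<bullet> v \<ge> 0}"
    unfolding tangent_cone_def
    by (rule closure_minimal) (auto simp: var closed_halfspace_ge)
  then have T: "?g \<bullet> v \<ge> 0" if "v \<in> ?T" for v using that by auto
  have "0 *\<^sub>R (x - x) \<in> {t *\<^sub>R (z - x) | t z. z \<in> S \<and> t \<ge> 0}"
    using assms(1) by blast
  then have 0: "0 \<in> ?T" unfolding tangent_cone_def using closure_subset by fastforce
  have sq: "(norm (v + ?g))\<^sup>2 \<ge> (norm v)\<^sup>2 + (norm ?g)\<^sup>2" if "v \<in> ?T" for v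
    using T[OF that] by (simp add: power2_norm_eq_inner algebra_simps inner_commute)
  have "norm ?g \<le> norm (v + ?g)" if "v \<in> ?T" for v
    using sq[OF that] by (smt (verit) norm_ge_zero power2_le_imp_le zero_le_power2)
  then have "is_arg_min (\<lambda>v. norm (v + ?g)) (\<lambda>v. v \<in> ?T) 0"
    using 0 by (auto simp: is_arg_min_linorder)
  then have "is_arg_min (\<lambda>v. norm (v + ?g)) (\<lambda>v. v \<in> ?T) (projected_gradient S f x)"
    unfolding projected_gradient_def arg_min_on_def arg_min_def by (rule someI)
  then have p: "projected_gradient S f x \<in> ?T"
    and "norm (projected_gradient S f x + ?g) \<le> norm (0 + ?g)"
    using 0 unfolding is_arg_min_linorder by blast+
  then have "(norm (projected_gradient S f x + ?g))\<^sup>2 \<le> (norm ?g)\<^sup>2"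
    by (simp add: power_mono)
  then have "(norm (projected_gradient S f x))\<^sup>2 \<le> 0" using sq[OF p] by linarith
  then show ?thesis by simp
qed

text \<open>A single accepted power \<open>\<delta> ^ P\<close> suffices: \<open>LEAST\<close> is
  then well defined and at most \<open>P\<close>, and powers of \<open>\<delta>\<close>
  decrease.\<close>

lemma line_search_bounds:
  fixes F :: "'a::real_inner \<Rightarrow> real"
  assumes delta: "0 < \<delta>" "\<delta> < 1" and "armijo F \<eta> u d (\<delta> ^ P)"
  shows "armijo F \<eta> u d (line_search F \<eta> \<delta> u d)"
    and "\<delta> ^ P \<le> line_search F \<eta> \<delta> u d" "line_search F \<eta> \<delta> u d \<le> 1"
proof -
  show "armijo F \<eta> u d (line_search F \<eta> \<delta> u d)"
    unfolding line_search_def by (rule LeastI) (rule assms(3))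
  have "(LEAST p. armijo F \<eta> u d (\<delta> ^ p)) \<le> P" by (rule Least_le) (rule assms(3))
  then show "\<delta> ^ P \<le> line_search F \<eta> \<delta> u d"
    unfolding line_search_def using delta by (intro power_decreasing) auto
  show "line_search F \<eta> \<delta> u d \<le> 1"
    unfolding line_search_def using delta by (intro power_le_one) auto
qed

text \<open>The convergence argument, separated from the concrete objective. \<open>Q u\<close>
  stands for the curvature of the model at \<open>u\<close> and enters only through its two uniform
  bounds; these force \<open>Q u 0 = 0\<close>, so \<open>K u\<close> is the model value at
  \<open>u\<close>.\<close>

lemma acquire_sequence_stationary:
  fixes F :: "'a::euclidean_space \<Rightarrow> real"
  assumes S: "closed S" "convex S"
    and grad: "\<And>u. u \<in> S \<Longrightarrow> gradient F u = g u" and g: "continuous_on S g"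
    and below: "\<And>u. u \<in> S \<Longrightarrow> F u \<ge> m"
    and level: "\<And>C. bounded {u \<in> S. F u \<le> C}"
    and upper: "\<And>u v. u \<in> S \<Longrightarrow> v \<in> S \<Longrightarrow> F v \<le> F u + g u \<bullet> (v - u) + L * (norm (v - u))\<^sup>2"
    and Fk: "\<And>u v. u \<in> S \<Longrightarrow> v \<in> S \<Longrightarrow> Fk u v = K u + g u \<bullet> (v - u) + Q u (v - u) / 2"
    and Fk_cont: "\<And>u. u \<in> S \<Longrightarrow> continuous_on S (Fk u)"
    and Q_lower: "\<And>u d. u \<in> S \<Longrightarrow> c * (norm d)\<^sup>2 \<le> Q u d"
    and Q_upper: "\<And>u d. u \<in> S \<Longrightarrow> Q u d \<le> M * (norm d)\<^sup>2"
    and pos: "c > 0" "L > 0" and eta: "0 < \<eta>" "\<eta> < 1" and delta: "0 < \<delta>" "\<delta> < 1"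
    and eps: "\<epsilon> \<longlonglongrightarrow> 0"
    and x: "acquire_sequence F Fk S \<eta> \<delta> \<epsilon> x"
  shows "\<exists>xbar\<in>S. \<exists>\<sigma>. strict_mono \<sigma> \<and> (x \<circ> \<sigma>) \<longlonglongrightarrow> xbar"
    and "\<And>xt \<sigma>. strict_mono \<sigma> \<Longrightarrow> (x \<circ> \<sigma>) \<longlonglongrightarrow> xt \<Longrightarrow> projected_gradient S F xt = 0"
proof -
  define X where "X k = arg_min_on (Fk (x k)) S" for k
  from x obtain xhat where x0: "x 0 \<in> S" and xhat: "\<And>k. xhat k \<in> S"
    and near: "\<And>k. norm (xhat k - X k) \<le> \<epsilon> k"
    and dec: "\<And>k. Fk (x k) (xhat k) \<le> Fk (x k) (x k)"
    and xSuc: "\<And>k. x (Suc k) = x k + line_search F \<eta> \<delta> (x k) (xhat k - x k) *\<^sub>R (xhat k - x k)"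
    unfolding acquire_sequence_def X_def Let_def by metis
  define d where "d k = xhat k - x k" for k
  define \<alpha> where "\<alpha> k = line_search F \<eta> \<delta> (x k) (d k)" for k
  have Q0: "Q u 0 = 0" if "u \<in> S" for u
    using Q_lower[OF that, of 0] Q_upper[OF that, of 0] by simp
  have seg: "u + t *\<^sub>R (v - u) \<in> S" if "u \<in> S" "v \<in> S" "0 \<le> t" "t \<le> 1" for u v t
  proof -
    have "(1 - t) *\<^sub>R u + t *\<^sub>R v \<in> S" using S(2) that unfolding convex_alt by blast
    then show ?thesis by (simp add: algebra_simps)
  qed
  \<comment> \<open>For a step length \<open>a\<close>, the majorant exceeds the linear prediction
    by at most \<open>L * a\<^sup>2 * (norm d)\<^sup>2\<close>. The Armijo test leaves a margin of
    \<open>(1 - \<eta>) * a\<close> times the slope, which is at least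
    \<open>c / 2 * (norm d)\<^sup>2\<close> in size. This threshold balances the two.\<close>
  have "0 < (1 - \<eta>) * c / (2 * L)" using eta pos by simp
  then obtain P where P: "\<delta> ^ P < (1 - \<eta>) * c / (2 * L)"
    using real_arch_pow_inv delta by blast
  have slope: "g (x k) \<bullet> d k \<le> - (c / 2) * (norm (d k))\<^sup>2" if "x k \<in> S" for k
    using dec[of k] Fk[OF that xhat] Fk[OF that that] Q0[OF that] Q_lower[OF that, of "d k"]
    by (simp add: d_def)
  have armijo_P: "armijo F \<eta> (x k) (d k) (\<delta> ^ P)" if k: "x k \<in> S" for k
  proof -
    let ?a = "\<delta> ^ P"
    have a: "0 < ?a" "?a \<le> 1" using delta by (auto simp: power_le_one)
    have "x k + ?a *\<^sub>R d k \<in> S" unfolding d_def using a k xhat by (intro seg) auto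
    from upper[OF k this]
    have "F (x k + ?a *\<^sub>R d k) \<le> F (x k) + ?a * (g (x k) \<bullet> d k) + L * (?a\<^sup>2 * (norm (d k))\<^sup>2)"
      by (simp add: power_mult_distrib)
    moreover have "L * (?a\<^sup>2 * (norm (d k))\<^sup>2) \<le> - (1 - \<eta>) * ?a * (g (x k) \<bullet> d k)"
    proof -
      have "L * ?a \<le> (1 - \<eta>) * (c / 2)" using P pos by (simp add: field_simps)
      then have "(L * ?a) * (norm (d k))\<^sup>2 \<le> ((1 - \<eta>) * (c / 2)) * (norm (d k))\<^sup>2"
        by (rule mult_right_mono) simp
      also have "\<dots> = (1 - \<eta>) * ((c / 2) * (norm (d k))\<^sup>2)" by simp
      also have "\<dots> \<le> (1 - \<eta>) * (- (g (x k) \<bullet> d k))"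
        using slope[OF k] eta by (intro mult_left_mono) auto
      finally have "?a * ((L * ?a) * (norm (d k))\<^sup>2) \<le> ?a * ((1 - \<eta>) * (- (g (x k) \<bullet> d k)))"
        using a by (intro mult_left_mono) auto
      then show ?thesis by (simp add: power2_eq_square algebra_simps)
    qed
    ultimately show ?thesis
      unfolding armijo_def grad[OF k] by (simp add: algebra_simps)
  qed
  \<comment> \<open>Feasibility can be proved only after acceptance: the step length lies in [0, 1]
    because some power is accepted at the feasible point \<open>x k\<close>, and convexity then
    keeps \<open>x (Suc k)\<close> in \<open>S\<close>.\<close>
  have xS: "x k \<in> S" for k
  proof (induction k)
    case (Suc k)
    have "0 \<le> \<alpha> k" "\<alpha> k \<le> 1"
      using line_search_bounds(2,3)[OF delta armijo_P[OF Suc]] zero_less_power[OF delta(1), of P]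
      unfolding \<alpha>_def by linarith+
    then show ?case
      unfolding xSuc using seg[OF Suc xhat] by (simp add: \<alpha>_def d_def)
  qed (rule x0)
  \<comment> \<open>The product of the Armijo factor, the least possible step length and the slope
    constant.\<close>
  define q where "q = \<eta> * \<delta> ^ P * (c / 2)"
  have q: "q > 0" using eta delta pos by (simp add: q_def)
  have descent: "F (x (Suc k)) \<le> F (x k) - q * (norm (d k))\<^sup>2" for k
  proof -
    note ls = line_search_bounds[OF delta armijo_P[OF xS], folded \<alpha>_def]
    have "F (x (Suc k)) \<le> F (x k) + \<eta> * \<alpha> k * (g (x k) \<bullet> d k)"
      using ls(1)[of k] unfolding armijo_def grad[OF xS] xSuc[folded d_def, folded \<alpha>_def] .
    moreover have "\<eta> * \<alpha> k * (g (x k) \<bullet> d k) \<le> \<eta> * \<alpha> k * (- (c / 2) * (norm (d k))\<^sup>2)"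
      using slope[OF xS] eta ls(2)[of k] zero_less_power[OF delta(1), of P]
      by (intro mult_left_mono) auto
    moreover have "\<eta> * \<delta> ^ P * ((c / 2) * (norm (d k))\<^sup>2) \<le> \<eta> * \<alpha> k * ((c / 2) * (norm (d k))\<^sup>2)"
      using ls(2)[of k] eta pos by (intro mult_right_mono mult_left_mono) auto
    ultimately show ?thesis unfolding q_def by (simp add: algebra_simps)
  qed
  then have Fdec: "decseq (\<lambda>k. F (x k))"
    by (intro decseq_SucI) (smt (verit) q zero_le_mult_iff zero_le_power2)
  then have "convergent (\<lambda>k. F (x k))"
    using below[OF xS] decseq_convergent[OF Fdec] by (metis convergent_def)
  then obtain l where l: "(\<lambda>k. F (x k)) \<longlonglongrightarrow> l" by (auto simp: convergent_def)
  \<comment> \<open>Consecutive values of \<open>F\<close> share the limit \<open>l\<close>, so the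
    descent inequality squeezes the squared step to 0.\<close>
  have "(\<lambda>k. (F (x k) - F (x (Suc k))) / q) \<longlonglongrightarrow> (l - l) / q"
    by (intro tendsto_intros l LIMSEQ_Suc) (use q in auto)
  then have "(\<lambda>k. (F (x k) - F (x (Suc k))) / q) \<longlonglongrightarrow> 0" by simp
  moreover have "norm ((norm (d k))\<^sup>2) \<le> (F (x k) - F (x (Suc k))) / q" for k
    using descent[of k] q by (simp add: field_simps)
  ultimately have "(\<lambda>k. (norm (d k))\<^sup>2) \<longlonglongrightarrow> 0"
    by (intro Lim_null_comparison[of "\<lambda>k. (norm (d k))\<^sup>2"]) auto
  then have "(\<lambda>k. sqrt ((norm (d k))\<^sup>2)) \<longlonglongrightarrow> sqrt 0" by (rule tendsto_real_sqrt)
  then have "d \<longlonglongrightarrow> 0" by (simp add: tendsto_norm_zero_iff)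
  moreover have "(\<lambda>k. X k - xhat k) \<longlonglongrightarrow> 0"
    by (rule Lim_null_comparison[OF _ eps]) (use near in \<open>auto simp: norm_minus_commute\<close>)
  ultimately have X_lim: "(\<lambda>k. X k - x k) \<longlonglongrightarrow> 0"
    using tendsto_add[of "\<lambda>k. X k - xhat k" 0 sequentially d 0] by (simp add: d_def)
  \<comment> \<open>Beyond the radius \<open>2 * norm (g (x k)) / c\<close> around
    \<open>x k\<close> the curvature term outweighs the linear one, so the model is no smaller there
    than at its centre and a minimizer exists.\<close>
  have X: "X k \<in> S" "v \<in> S \<Longrightarrow> Fk (x k) (X k) \<le> Fk (x k) v" for k v
  proof -
    have "Fk (x k) v \<ge> Fk (x k) (x k)"
      if "v \<in> S" "norm (v - x k) > 2 * norm (g (x k)) / c" for v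
    proof -
      let ?w = "v - x k"
      have "c / 2 * norm ?w \<ge> norm (g (x k))"
        using that(2) pos by (simp add: field_simps)
      then have "c / 2 * norm ?w * norm ?w \<ge> norm (g (x k)) * norm ?w"
        by (rule mult_right_mono) simp
      moreover have "- (g (x k) \<bullet> ?w) \<le> norm (g (x k)) * norm ?w"
        using Cauchy_Schwarz_ineq2[of "g (x k)" ?w] by linarith
      ultimately show ?thesis
        using Q_lower[OF xS, of ?w k] Q0[OF xS] Fk[OF xS that(1), of k] Fk[OF xS xS, of k k]
        by (simp add: power2_eq_square)
    qed
    from is_arg_min_arg_min_on[OF S(1) xS Fk_cont[OF xS] this]
    show "X k \<in> S" "v \<in> S \<Longrightarrow> Fk (x k) (X k) \<le> Fk (x k) v" unfolding X_def by auto
  qed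
  have "bounded (range x)"
    by (rule bounded_subset[OF level[of "F (x 0)"]])
      (use xS Fdec in \<open>auto simp: decseq_def\<close>)
  then obtain xbar \<sigma> where "strict_mono \<sigma>" "(x \<circ> \<sigma>) \<longlonglongrightarrow> xbar"
    using bounded_imp_convergent_subsequence[of x] by blast
  moreover have "xbar \<in> S"
    using closed_sequentially[OF S(1), of "x \<circ> \<sigma>"] calculation xS by auto
  ultimately show "\<exists>xbar\<in>S. \<exists>\<sigma>. strict_mono \<sigma> \<and> (x \<circ> \<sigma>) \<longlonglongrightarrow> xbar" by blast
  show "projected_gradient S F xt = 0" if \<sigma>: "strict_mono \<sigma>" and lim: "(x \<circ> \<sigma>) \<longlonglongrightarrow> xt" for xt \<sigma>
  proof -
    have xt: "xt \<in> S"
      using closed_sequentially[OF S(1), of "x \<circ> \<sigma>"] lim xS by auto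
    have gl: "(\<lambda>k. g (x (\<sigma> k))) \<longlonglongrightarrow> g xt"
      using g lim xt xS unfolding continuous_on_sequentially by (simp add: o_def)
    have xl: "(\<lambda>k. x (\<sigma> k)) \<longlonglongrightarrow> xt" using lim by (simp add: o_def)
    have Xl: "(\<lambda>k. X (\<sigma> k) - x (\<sigma> k)) \<longlonglongrightarrow> 0"
      using LIMSEQ_subseq_LIMSEQ[OF X_lim \<sigma>] by (simp add: o_def)
    show ?thesis
    proof (rule projected_gradient_eq_0[OF xt], unfold grad[OF xt])
      fix z assume z: "z \<in> S"
      \<comment> \<open>Here \<open>t\<close> is fixed while \<open>k\<close> tends to infinity
        along \<open>\<sigma>\<close>. The curvature \<open>Q (x k)\<close> varies with
        \<open>k\<close>, so it is replaced by 0 at the minimizer and by the bound \<open>M\<close>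
        at the comparison point before passing to the limit. Dividing by \<open>t\<close> leaves a
        remainder of order \<open>t\<close>.\<close>
      have quad: "0 \<le> g xt \<bullet> (z - xt) + t * (M / 2 * (norm (z - xt))\<^sup>2)" if t: "0 < t" "t \<le> 1" for t
      proof -
        have "g (x k) \<bullet> (X k - x k) \<le> t * (g (x k) \<bullet> (z - x k)) + M / 2 * (t\<^sup>2 * (norm (z - x k))\<^sup>2)"
          for k
        proof -
          have w: "x k + t *\<^sub>R (z - x k) \<in> S" using t z xS by (intro seg) auto
          have "0 \<le> Q (x k) (X k - x k)"
            using Q_lower[OF xS, of "X k - x k" k] pos
            by (smt (verit) mult_nonneg_nonneg zero_le_power2)
          with X(2)[OF w, of k] Fk[OF xS w, of k] Fk[OF xS X(1), of k k]
            Q_upper[OF xS, of k "t *\<^sub>R (z - x k)"]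
          show ?thesis by (simp add: power_mult_distrib)
        qed
        moreover have "(\<lambda>k. t * (g (x (\<sigma> k)) \<bullet> (z - x (\<sigma> k))) + M / 2 * (t\<^sup>2 * (norm (z - x (\<sigma> k)))\<^sup>2))
            \<longlonglongrightarrow> t * (g xt \<bullet> (z - xt)) + M / 2 * (t\<^sup>2 * (norm (z - xt))\<^sup>2)"
          by (intro tendsto_intros gl xl)
        ultimately have "g xt \<bullet> 0 \<le> t * (g xt \<bullet> (z - xt)) + M / 2 * (t\<^sup>2 * (norm (z - xt))\<^sup>2)"
          using LIMSEQ_le[OF tendsto_inner[OF gl Xl]] by blast
        then have "0 \<le> t * (g xt \<bullet> (z - xt) + t * (M / 2 * (norm (z - xt))\<^sup>2))"
          by (simp add: power2_eq_square algebra_simps)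
        then show ?thesis using t by (simp add: zero_le_mult_iff)
      qed
      have "((\<lambda>t. g xt \<bullet> (z - xt) + t * (M / 2 * (norm (z - xt))\<^sup>2)) \<longlongrightarrow>
          g xt \<bullet> (z - xt) + 0 * (M / 2 * (norm (z - xt))\<^sup>2)) (at_right 0)"
        by (intro tendsto_intros)
      moreover have "\<forall>\<^sub>F t in at_right (0::real). 0 < t \<and> t \<le> 1"
        unfolding eventually_at_right_field by (intro exI[of _ 1]) auto
      then have "\<forall>\<^sub>F t in at_right 0. 0 \<le> g xt \<bullet> (z - xt) + t * (M / 2 * (norm (z - xt))\<^sup>2)"
        by (rule eventually_mono) (simp only: quad)
      ultimately have "0 \<le> g xt \<bullet> (z - xt) + 0 * (M / 2 * (norm (z - xt))\<^sup>2)"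
        by (rule tendsto_lowerbound) simp
      then show "0 \<le> g xt \<bullet> (z - xt)" by simp
    qed
  qed
qed

section \<open>Derivatives of the objective\<close>

text \<open>The relative error is at most \<open>C * norm (w - v)\<close>. This allows a gradient to
  be read off from a quadratic majorant and an affine minorant, without differentiating the
  piecewise \<open>huber\<close> of a norm.\<close>

lemma gderiv_quadratic:
  fixes f :: "'a::real_inner \<Rightarrow> real"
  assumes "\<And>w. \<bar>f w - f v - g \<bullet> (w - v)\<bar> \<le> C * (norm (w - v))\<^sup>2"
  shows "GDERIV f v :> g"
  unfolding gderiv_def
proof (rule has_derivativeI_sandwich[where e = 1 and H = "\<lambda>w. C * norm (w - v)"])
  show "bounded_linear (\<lambda>h. h \<bullet> g)" by (rule bounded_linear_inner_left)
  show "norm (f w - f v - (w - v) \<bullet> g) / norm (w - v) \<le> C * norm (w - v)" if "w \<noteq> v" for w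
    using assms[of w] that by (simp add: field_simps power2_eq_square inner_commute)
  have "((\<lambda>w. C * norm (w - v)) \<longlongrightarrow> C * norm (v - v)) (at v)" by (intro tendsto_intros)
  then show "((\<lambda>w. C * norm (w - v)) \<longlongrightarrow> 0) (at v)" by simp
qed auto

text \<open>The reweighted quadratic is tight because \<open>huber \<mu> z\<close> is the minimum of
  \<open>(z\<^sup>2 / t + t) / 2\<close> over \<open>t \<ge> \<mu>\<close>, attained at \<open>t = max \<mu> \<bar>z\<bar>\<close>.\<close>

lemma huber_norm_eq:
  assumes "\<mu> > 0"
  shows "huber \<mu> (norm v) = ((norm v)\<^sup>2 / max \<mu> (norm v) + max \<mu> (norm v)) / 2"
  using assms by (auto simp: huber_def max_def power2_eq_square)

lemma huber_norm_nonneg: "\<mu> > 0 \<Longrightarrow> 0 \<le> huber \<mu> (norm v)"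
  by (simp add: huber_norm_eq)

text \<open>Write \<open>z\<close> for \<open>norm v\<close>. If \<open>z > \<mu>\<close>, this is
  the arithmetic-geometric mean inequality; otherwise \<open>z\<^sup>2 / t + t\<close> is
  nondecreasing for \<open>t \<ge> \<mu>\<close>, because \<open>\<mu> \<ge> z\<close>.\<close>

lemma huber_norm_le:
  assumes "\<mu> > 0" "m \<ge> \<mu>"
  shows "huber \<mu> (norm v) \<le> ((norm v)\<^sup>2 / m + m) / 2"
proof (cases "norm v > \<mu>")
  case True
  have "0 \<le> (norm v - m)\<^sup>2 / m" using assms by simp
  then have "2 * norm v \<le> (norm v)\<^sup>2 / m + m"
    using assms by (simp add: power2_eq_square field_simps)
  then show ?thesis using True by (simp add: huber_def)
next
  case False
  have "(norm v)\<^sup>2 * (m - \<mu>) \<le> (m * \<mu>) * (m - \<mu>)"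
    using False assms by (intro mult_right_mono) (auto simp: power2_eq_square intro!: mult_mono)
  then have "(norm v)\<^sup>2 / \<mu> + \<mu> \<le> (norm v)\<^sup>2 / m + m"
    using assms by (simp add: field_simps power2_eq_square)
  moreover have "huber \<mu> (norm v) = ((norm v)\<^sup>2 / \<mu> + \<mu>) / 2"
    using False by (simp add: huber_def)
  ultimately show ?thesis by (simp only: divide_right_mono zero_le_numeral)
qed

text \<open>Freezing the parameter at the value optimal for \<open>v\<close> gives a quadratic in
  \<open>w\<close> that majorizes and touches at \<open>v\<close>.\<close>

lemma huber_norm_upper:
  fixes v w :: "'a::real_inner"
  assumes "\<mu> > 0" and m: "m = max \<mu> (norm v)"
  shows "huber \<mu> (norm w) \<le> huber \<mu> (norm v) + v \<bullet> (w - v) / m + (norm (w - v))\<^sup>2 / (2 * m)"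
proof -
  have "(norm w)\<^sup>2 = (norm v)\<^sup>2 + 2 * (v \<bullet> (w - v)) + (norm (w - v))\<^sup>2"
    by (simp add: power2_norm_eq_inner algebra_simps inner_commute)
  then have "((norm w)\<^sup>2 / m + m) / 2
      = ((norm v)\<^sup>2 / m + m) / 2 + v \<bullet> (w - v) / m + (norm (w - v))\<^sup>2 / (2 * m)"
    by (simp add: add_divide_distrib)
  moreover have "m \<ge> \<mu>" using m by simp
  ultimately show ?thesis
    using huber_norm_le[OF assms(1), of m w] huber_norm_eq[OF assms(1), of v, folded m]
    by (simp only:)
qed

text \<open>Convexity in dual form: for \<open>p \<ge> 0\<close>, \<open>huber \<mu> p\<close> is
  the maximum of \<open>a * p + \<mu> * (1 - a\<^sup>2) / 2\<close> over \<open>a\<close> in [0, 1].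
  By Cauchy-Schwarz the tangent at \<open>v\<close> lies below the member with
  \<open>a = norm v / m\<close>.\<close>

lemma huber_norm_lower:
  fixes v w :: "'a::real_inner"
  assumes "\<mu> > 0" and m: "m = max \<mu> (norm v)"
  shows "huber \<mu> (norm w) \<ge> huber \<mu> (norm v) + v \<bullet> (w - v) / m"
proof -
  define a p where "a = norm v / m" and "p = norm w"
  have mp: "m > 0" using assms by simp
  have a: "0 \<le> a" "a \<le> 1" "norm v = a * m" using mp m by (auto simp: a_def)
  have "v \<bullet> w \<le> (a * p) * m"
    using norm_cauchy_schwarz[of v w] a(3) by (simp add: p_def mult_ac)
  then have "v \<bullet> w / m \<le> a * p" using mp by (simp add: field_simps)
  moreover have "huber \<mu> (norm v) + v \<bullet> (w - v) / m = v \<bullet> w / m + m * (1 - a\<^sup>2) / 2"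
  proof -
    have "v \<bullet> v / m = a\<^sup>2 * m"
      using mp a(3) by (simp add: power2_eq_square flip: power2_norm_eq_inner)
    moreover have "(norm v)\<^sup>2 / m = a\<^sup>2 * m"
      using mp a(3) by (simp add: power2_eq_square)
    ultimately show ?thesis
      using huber_norm_eq[OF assms(1), of v, folded m]
      by (simp add: inner_diff_right diff_divide_distrib algebra_simps)
  qed
  \<comment> \<open>Either \<open>a = 1\<close> and both sides vanish, or
    \<open>m = \<mu>\<close>.\<close>
  moreover have "m * (1 - a\<^sup>2) = \<mu> * (1 - a\<^sup>2)"
  proof (cases "norm v > \<mu>")
    case True
    then have "a = 1" using m mp by (simp add: a_def)
    then show ?thesis by simp
  qed (use m in simp)
  \<comment> \<open>The gap is \<open>(1 - a) * (p - \<mu> * (1 + a) / 2)\<close> on the linear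
    branch and \<open>(p - a * \<mu>)\<^sup>2 / (2 * \<mu>)\<close> on the quadratic one.\<close>
  moreover have "a * p + \<mu> * (1 - a\<^sup>2) / 2 \<le> huber \<mu> p"
  proof (cases "p > \<mu>")
    case True
    have "\<mu> * (1 + a) \<le> p * 2" using True a assms(1) by (intro mult_mono) auto
    then have "0 \<le> (1 - a) * (p - \<mu> * (1 + a) / 2)" using a by simp
    then show ?thesis using True assms(1)
      by (simp add: huber_def power2_eq_square field_simps)
  next
    case False
    have "0 \<le> (p - a * \<mu>)\<^sup>2 / (2 * \<mu>)" using assms(1) by simp
    then show ?thesis using False assms(1)
      by (simp add: huber_def p_def power2_eq_square field_simps)
  qed
  ultimately show ?thesis by (simp add: p_def)
qed

section \<open>Smoothed total variation: gradient and curvature bounds\<close>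

definition TV_grad :: "('n \<Rightarrow> real^'n^2) \<Rightarrow> real \<Rightarrow> real^'n \<Rightarrow> real^'n" where
  "TV_grad D \<mu> u = (\<Sum>i\<in>UNIV. TV_weight D \<mu> u i *\<^sub>R (transpose (D i) *v (D i *v u)))"

lemma inner_TV_grad:
  "TV_grad D \<mu> u \<bullet> d = (\<Sum>i\<in>UNIV. TV_weight D \<mu> u i * ((D i *v u) \<bullet> (D i *v d)))"
  unfolding TV_grad_def inner_sum_left inner_scaleR_left
  by (simp add: dot_lmul_matrix transpose_matrix_vector)

lemma TV_weight_eq: "TV_weight D \<mu> u i = 1 / max \<mu> (norm (D i *v u))"
  by (auto simp: TV_weight_def max_def inverse_eq_divide)

lemma TV_weight_bounds:
  assumes "\<mu> > 0"
  shows "0 \<le> TV_weight D \<mu> u i" "TV_weight D \<mu> u i \<le> 1 / \<mu>"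
  using assms by (auto simp: TV_weight_eq intro!: divide_left_mono)

definition TV_bound :: "('n \<Rightarrow> real^'n^2) \<Rightarrow> real \<Rightarrow> real" where
  "TV_bound D \<mu> = (\<Sum>i\<in>UNIV. (onorm ((*v) (D i)))\<^sup>2 / \<mu>)"

lemma TV_bound_nonneg: "\<mu> > 0 \<Longrightarrow> 0 \<le> TV_bound D \<mu>"
  unfolding TV_bound_def by (intro sum_nonneg) simp

lemma TV_form_bounds:
  assumes "\<mu> > 0"
  shows "0 \<le> (\<Sum>i\<in>UNIV. TV_weight D \<mu> u i * (norm (D i *v d))\<^sup>2)"
    and "(\<Sum>i\<in>UNIV. TV_weight D \<mu> u i * (norm (D i *v d))\<^sup>2) \<le> TV_bound D \<mu> * (norm d)\<^sup>2"
proof -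
  show "0 \<le> (\<Sum>i\<in>UNIV. TV_weight D \<mu> u i * (norm (D i *v d))\<^sup>2)"
    using TV_weight_bounds[OF assms] by (intro sum_nonneg mult_nonneg_nonneg) auto
  have "TV_weight D \<mu> u i * (norm (D i *v d))\<^sup>2 \<le> (onorm ((*v) (D i)))\<^sup>2 / \<mu> * (norm d)\<^sup>2" for i
  proof -
    have "norm (D i *v d) \<le> onorm ((*v) (D i)) * norm d"
      by (rule onorm) simp
    then have "(norm (D i *v d))\<^sup>2 \<le> (onorm ((*v) (D i)) * norm d)\<^sup>2"
      by (rule power_mono) simp
    then have "TV_weight D \<mu> u i * (norm (D i *v d))\<^sup>2 \<le> 1 / \<mu> * (onorm ((*v) (D i)) * norm d)\<^sup>2"
      using TV_weight_bounds[OF assms] assms by (intro mult_mono) auto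
    then show ?thesis by (simp add: power_mult_distrib)
  qed
  then show "(\<Sum>i\<in>UNIV. TV_weight D \<mu> u i * (norm (D i *v d))\<^sup>2) \<le> TV_bound D \<mu> * (norm d)\<^sup>2"
    unfolding TV_bound_def sum_distrib_right by (rule sum_mono)
qed

lemma TV_upper:
  assumes "\<mu> > 0"
  shows "TV D \<mu> v \<le> TV D \<mu> u + TV_grad D \<mu> u \<bullet> (v - u) + TV_bound D \<mu> * (norm (v - u))\<^sup>2"
proof -
  have "TV D \<mu> v \<le> (\<Sum>i\<in>UNIV. huber \<mu> (norm (D i *v u))
      + TV_weight D \<mu> u i * ((D i *v u) \<bullet> (D i *v (v - u)))
      + TV_weight D \<mu> u i * (norm (D i *v (v - u)))\<^sup>2)"
    unfolding TV_def
  proof (rule sum_mono)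
    fix i
    let ?m = "max \<mu> (norm (D i *v u))"
    \<comment> \<open>A factor 1/2 is given up so that \<open>TV_bound\<close> serves both for the
      model curvature and for this majorant.\<close>
    have "(norm (D i *v (v - u)))\<^sup>2 / (2 * ?m) \<le> (norm (D i *v (v - u)))\<^sup>2 / ?m"
      using assms by (intro divide_left_mono) auto
    then show "huber \<mu> (norm (D i *v v)) \<le> huber \<mu> (norm (D i *v u))
      + TV_weight D \<mu> u i * ((D i *v u) \<bullet> (D i *v (v - u)))
      + TV_weight D \<mu> u i * (norm (D i *v (v - u)))\<^sup>2"
      using huber_norm_upper[OF assms refl, of "D i *v v" "D i *v u"]
      by (simp add: TV_weight_eq matrix_vector_mult_diff_distrib)
  qed
  then show ?thesis
    using TV_form_bounds(2)[OF assms, of D u "v - u"]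
    by (simp add: sum.distrib inner_TV_grad TV_def)
qed

lemma TV_lower:
  assumes "\<mu> > 0"
  shows "TV D \<mu> v \<ge> TV D \<mu> u + TV_grad D \<mu> u \<bullet> (v - u)"
  unfolding TV_def inner_TV_grad sum.distrib[symmetric]
  using huber_norm_lower[OF assms refl, of "D _ *v u" "D _ *v v"]
  by (intro sum_mono) (simp add: TV_weight_eq matrix_vector_mult_diff_distrib)

text \<open>Majorant and minorant share the linear part \<open>TV_grad\<close>. The same vector is
  the gradient at \<open>u\<close> of the reweighted quadratic in \<open>TV_model\<close>, which is
  why model and objective agree to first order.\<close>

lemma GDERIV_TV:
  assumes "\<mu> > 0"
  shows "GDERIV (TV D \<mu>) u :> TV_grad D \<mu> u"
  by (rule gderiv_quadratic[where C = "TV_bound D \<mu>"])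
    (use TV_upper[OF assms, of D _ u] TV_lower[OF assms, of D u] in \<open>simp add: abs_le_iff algebra_simps\<close>)

lemma TV_nonneg: "\<mu> > 0 \<Longrightarrow> 0 \<le> TV D \<mu> u"
  unfolding TV_def by (intro sum_nonneg) (simp add: huber_norm_nonneg)

lemma continuous_on_TV_grad:
  assumes "\<mu> > 0"
  shows "continuous_on S (TV_grad D \<mu>)"
proof -
  have "max \<mu> (norm (D i *v u)) \<noteq> 0" for i u using assms by linarith
  then show ?thesis
    unfolding TV_grad_def TV_weight_eq
    by (intro continuous_intros matrix_vector_mult_linear_continuous_on
        continuous_on_compose2[OF matrix_vector_mult_linear_continuous_on]) auto
qed

section \<open>Kullback-Leibler term: scalar estimates, derivatives, coercivity\<close>

definition kl :: "real \<Rightarrow> real \<Rightarrow> real" where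
  "kl y t = (if y = 0 then 0 else y * ln (y / t)) + t - y"

lemma D_KL_eq: "D_KL A b y u = (\<Sum>j\<in>UNIV. kl (y $ j) ((A *v u + b) $ j))"
  by (simp only: D_KL_def kl_def)

lemma DERIV_kl:
  assumes "t > 0" "y \<ge> 0"
  shows "DERIV (kl y) t :> 1 - y / t"
proof (cases "y = 0")
  case True
  then have "kl y = (\<lambda>t. t)" by (auto simp: kl_def)
  then show ?thesis using True by simp
next
  case False
  then show ?thesis
    unfolding kl_def[abs_def] using assms
    by (auto intro!: derivative_eq_intros simp: field_simps)
qed

text \<open>Uses \<open>ln s \<le> s - 1\<close> at \<open>s = t / t'\<close>, where
  \<open>s - 1\<close> splits exactly into the tangent term and a square over \<open>t * t'\<close>;
  the bound \<open>\<beta>\<close> controls that denominator.\<close>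

lemma kl_upper:
  assumes "0 < \<beta>" "\<beta> \<le> t" "\<beta> \<le> t'" "y \<ge> 0"
  shows "kl y t' \<le> kl y t + (1 - y / t) * (t' - t) + y / \<beta>\<^sup>2 * (t' - t)\<^sup>2"
proof (cases "y = 0")
  case False
  have t: "0 < t" "0 < t'" using assms by auto
  have "ln (t / t') \<le> t / t' - 1" using t by (intro ln_le_minus_one) simp
  also have "\<dots> = - (t' - t) / t + (t' - t)\<^sup>2 / (t * t')"
    using t by (simp add: field_simps power2_eq_square)
  also have "(t' - t)\<^sup>2 / (t * t') \<le> (t' - t)\<^sup>2 / \<beta>\<^sup>2"
    using assms t by (intro divide_left_mono) (auto simp: power2_eq_square intro!: mult_mono)
  finally have "y * ln (t / t') \<le> y * (- (t' - t) / t + (t' - t)\<^sup>2 / \<beta>\<^sup>2)"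
    using assms(4) by (intro mult_left_mono) auto
  then show ?thesis
    using False assms(4) t by (simp add: kl_def ln_div algebra_simps diff_divide_distrib)
qed (simp add: kl_def)

text \<open>Linear growth, from \<open>ln s \<le> s - 1\<close> at \<open>s = t / (2 * y)\<close>:
  the factor 2 leaves half of \<open>t\<close> after the logarithm is absorbed.\<close>

lemma kl_lower:
  assumes "t > 0" "y \<ge> 0"
  shows "kl y t \<ge> t / 2 - y * ln 2"
proof (cases "y = 0")
  case False
  with assms have "ln (t / (2 * y)) \<le> t / (2 * y) - 1" by (intro ln_le_minus_one) simp
  then have "y * ln (t / (2 * y)) \<le> y * (t / (2 * y) - 1)"
    using assms by (intro mult_left_mono) auto
  also have "\<dots> = t / 2 - y" using False by (simp add: field_simps)
  also have "y * ln (t / (2 * y)) = - (y * ln (y / t)) - y * ln 2"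
    using False assms by (simp add: ln_div ln_mult algebra_simps)
  finally show ?thesis using False by (simp add: kl_def)
qed (use assms in \<open>simp add: kl_def\<close>)

definition KL_grad :: "real^'n^'m \<Rightarrow> real^'m \<Rightarrow> real^'m \<Rightarrow> real^'n \<Rightarrow> real^'n" where
  "KL_grad A b y u = (\<Sum>j\<in>UNIV. (1 - y $ j / (A *v u + b) $ j) *\<^sub>R A $ j)"

definition KL_form :: "real^'n^'m \<Rightarrow> real^'m \<Rightarrow> real^'m \<Rightarrow> real^'n \<Rightarrow> real^'n \<Rightarrow> real" where
  "KL_form A b y u d = (\<Sum>j\<in>UNIV. y $ j / ((A *v u + b) $ j)\<^sup>2 * ((A *v d) $ j)\<^sup>2)"

lemma affine_component_has_derivative:
  "((\<lambda>u. (A *v u + b) $ j) has_derivative (\<lambda>d. A $ j \<bullet> d)) (at u)" for A :: "real^'n^'m"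
  by (simp add: matrix_vector_mul_component) (auto intro!: derivative_eq_intros)

lemma GDERIV_D_KL:
  fixes A :: "real^'n^'m"
  assumes "\<And>j. (A *v u + b) $ j > 0" "\<And>j. y $ j \<ge> 0"
  shows "GDERIV (D_KL A b y) u :> KL_grad A b y u"
proof -
  have "((\<lambda>u. \<Sum>j\<in>UNIV. kl (y $ j) ((A *v u + b) $ j)) has_derivative
    (\<lambda>d. \<Sum>j\<in>UNIV. (1 - y $ j / (A *v u + b) $ j) * (A $ j \<bullet> d))) (at u)"
    using has_derivative_compose[OF affine_component_has_derivative
        DERIV_kl[OF assms(1,2), unfolded has_field_derivative_def]]
    by (intro has_derivative_sum) blast
  then show ?thesis
    unfolding gderiv_def D_KL_eq[abs_def] KL_grad_def
    by (simp add: inner_sum_right inner_commute)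
qed

text \<open>\<open>hessian\<close> differentiates \<open>gradient (D_KL A b y)\<close>, which is
  identified with \<open>KL_grad\<close> on this set; openness lets the derivative be transferred
  from one to the other.\<close>

lemma open_KL_domain: "open {u. \<forall>j. (A *v u + b) $ j > 0}" for A :: "real^'n^'m"
  unfolding Collect_all_eq
  by (intro open_INT) (auto intro!: open_Collect_less continuous_intros
      matrix_vector_mult_linear_continuous_on simp: matrix_vector_mul_component)

lemma hessian_D_KL:
  fixes A :: "real^'n^'m"
  assumes pos: "\<And>j. (A *v u + b) $ j > 0" and y: "\<And>j. y $ j \<ge> 0"
  shows "d \<bullet> (hessian (D_KL A b y) u *v d) = KL_form A b y u d"
proof -
  let ?U = "{u. \<forall>j. (A *v u + b) $ j > 0}"
  define H where
    "H d = (\<Sum>j\<in>UNIV. (y $ j / ((A *v u + b) $ j)\<^sup>2 * (A $ j \<bullet> d)) *\<^sub>R A $ j)" for d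
  have "((\<lambda>u. (1 - y $ j / (A *v u + b) $ j) *\<^sub>R A $ j) has_derivative
     (\<lambda>d. (y $ j / ((A *v u + b) $ j)\<^sup>2 * (A $ j \<bullet> d)) *\<^sub>R A $ j)) (at u)" for j
    by (rule derivative_eq_intros affine_component_has_derivative refl)+
      (use pos[of j] in \<open>auto simp: fun_eq_iff power2_eq_square field_simps\<close>)
  then have "(KL_grad A b y has_derivative H) (at u)"
    unfolding KL_grad_def[abs_def] H_def[abs_def] by (intro has_derivative_sum)
  then have der: "(gradient (D_KL A b y) has_derivative H) (at u)"
  proof (rule has_derivative_transform_within_open[OF _ open_KL_domain[of A b]])
    show "KL_grad A b y w = gradient (D_KL A b y) w" if "w \<in> ?U" for w
      using gradient_eqI[OF GDERIV_D_KL, of A w b y] that y by auto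
  qed (use pos in auto)
  then have "hessian (D_KL A b y) u *v d = H d"
    unfolding hessian_def jacobian_def frechet_derivative_at[OF der, symmetric]
    using has_derivative_linear[OF der] by (simp add: matrix_works linear_matrix_vector_mul_eq)
  then show ?thesis
    by (simp add: H_def KL_form_def inner_sum_right matrix_vector_mul_component
        power2_eq_square inner_commute algebra_simps)
qed

text \<open>The source of uniformity: on the orthant the denominators of the data term stay above
  \<open>b $ j\<close>, whatever the iterate.\<close>

lemma affine_ge:
  fixes A :: "real^'n^'m"
  assumes "\<And>i j. A $ i $ j \<ge> 0" "\<And>i. u $ i \<ge> 0"
  shows "(A *v u + b) $ j \<ge> b $ j"
  using assms by (simp add: matrix_vector_mult_def sum_nonneg)

definition KL_bound :: "real^'n^'m \<Rightarrow> real^'m \<Rightarrow> real^'m \<Rightarrow> real" where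
  "KL_bound A b y = (\<Sum>j\<in>UNIV. y $ j / (b $ j)\<^sup>2 * (norm (A $ j))\<^sup>2)"

lemma KL_bound_nonneg: "(\<And>j. y $ j \<ge> 0) \<Longrightarrow> 0 \<le> KL_bound A b y"
  unfolding KL_bound_def by (intro sum_nonneg) simp

lemma KL_component_le: "((A *v d) $ j)\<^sup>2 \<le> (norm (A $ j))\<^sup>2 * (norm d)\<^sup>2" for A :: "real^'n^'m"
  by (metis Cauchy_Schwarz_ineq matrix_vector_mul_component power2_norm_eq_inner)

lemma KL_form_bounds:
  fixes A :: "real^'n^'m"
  assumes ge: "\<And>j. (A *v u + b) $ j \<ge> b $ j" and b: "\<And>j. b $ j > 0" and y: "\<And>j. y $ j \<ge> 0"
  shows "0 \<le> KL_form A b y u d" "KL_form A b y u d \<le> KL_bound A b y * (norm d)\<^sup>2"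
proof -
  show "0 \<le> KL_form A b y u d" unfolding KL_form_def using y by (intro sum_nonneg) simp
  have "y $ j / ((A *v u + b) $ j)\<^sup>2 * ((A *v d) $ j)\<^sup>2
      \<le> y $ j / (b $ j)\<^sup>2 * ((norm (A $ j))\<^sup>2 * (norm d)\<^sup>2)" for j
  proof (rule mult_mono[OF _ KL_component_le])
    have "0 < (A *v u + b) $ j" using ge[of j] b[of j] by linarith
    then show "y $ j / ((A *v u + b) $ j)\<^sup>2 \<le> y $ j / (b $ j)\<^sup>2"
      using ge[of j] b[of j] y[of j]
      by (intro divide_left_mono mult_pos_pos power_mono) auto
  qed (use y in auto)
  then show "KL_form A b y u d \<le> KL_bound A b y * (norm d)\<^sup>2"
    unfolding KL_form_def KL_bound_def sum_distrib_right by (intro sum_mono) (simp add: mult_ac)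
qed

text \<open>\<open>kl_upper\<close> with \<open>\<beta> = b $ j\<close> in each component, followed
  by Cauchy-Schwarz on the rows of \<open>A\<close>.\<close>

lemma D_KL_upper:
  fixes A :: "real^'n^'m"
  assumes ge: "\<And>j. (A *v u + b) $ j \<ge> b $ j" "\<And>j. (A *v v + b) $ j \<ge> b $ j"
    and b: "\<And>j. b $ j > 0" and y: "\<And>j. y $ j \<ge> 0"
  shows "D_KL A b y v \<le> D_KL A b y u + KL_grad A b y u \<bullet> (v - u) + KL_bound A b y * (norm (v - u))\<^sup>2"
proof -
  have diff: "(A *v v + b) $ j - (A *v u + b) $ j = (A *v (v - u)) $ j" for j
    by (simp add: matrix_vector_mult_diff_distrib)
  have "kl (y $ j) ((A *v v + b) $ j) \<le> kl (y $ j) ((A *v u + b) $ j)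
      + (1 - y $ j / (A *v u + b) $ j) * (A $ j \<bullet> (v - u))
      + y $ j / (b $ j)\<^sup>2 * (norm (A $ j))\<^sup>2 * (norm (v - u))\<^sup>2" for j
  proof -
    have "y $ j / (b $ j)\<^sup>2 * ((A *v (v - u)) $ j)\<^sup>2
        \<le> y $ j / (b $ j)\<^sup>2 * ((norm (A $ j))\<^sup>2 * (norm (v - u))\<^sup>2)"
      using y by (intro mult_left_mono KL_component_le) auto
    then show ?thesis
      using kl_upper[OF b[of j] ge(1)[of j] ge(2)[of j] y[of j], unfolded diff]
      by (simp only: matrix_vector_mul_component mult.assoc)
  qed
  then show ?thesis
    unfolding D_KL_eq KL_grad_def KL_bound_def inner_sum_left inner_scaleR_left
      sum_distrib_right sum.distrib[symmetric]
    by (rule sum_mono)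
qed

lemma continuous_on_KL_grad:
  fixes A :: "real^'n^'m"
  assumes "\<And>u j. u \<in> S \<Longrightarrow> (A *v u + b) $ j > 0"
  shows "continuous_on S (KL_grad A b y)"
  unfolding KL_grad_def[abs_def]
  by (intro continuous_intros matrix_vector_mult_linear_continuous_on)
    (metis assms less_irrefl)

text \<open>Coercivity on the orthant: unit column sums give \<open>\<Sum>j. (A *v u) $ j = \<Sum>i. u $ i\<close>.\<close>

lemma D_KL_lower:
  fixes A :: "real^'n^'m"
  assumes A: "\<And>i j. A $ i $ j \<ge> 0" "\<And>j. (\<Sum>i\<in>UNIV. A $ i $ j) = 1"
    and b: "\<And>j. b $ j > 0" and y: "\<And>j. y $ j \<ge> 0" and u: "\<And>i. u $ i \<ge> 0"
  shows "D_KL A b y u \<ge> norm u / 2 - (\<Sum>j\<in>UNIV. y $ j * ln 2)"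
proof -
  have "norm u \<le> (\<Sum>i\<in>UNIV. \<bar>u $ i\<bar>)" by (rule norm_le_l1_cart)
  also have "\<dots> = (\<Sum>i\<in>UNIV. (\<Sum>j\<in>UNIV. A $ j $ i) * u $ i)" using A(2) u by simp
  also have "\<dots> = (\<Sum>j\<in>UNIV. (A *v u) $ j)"
    unfolding sum_distrib_right matrix_vector_mult_def by (subst sum.swap) simp
  also have "\<dots> \<le> (\<Sum>j\<in>UNIV. (A *v u + b) $ j)"
    using b by (intro sum_mono) (simp add: less_imp_le)
  finally have "norm u / 2 - (\<Sum>j\<in>UNIV. y $ j * ln 2)
      \<le> (\<Sum>j\<in>UNIV. (A *v u + b) $ j / 2 - y $ j * ln 2)"
    by (simp add: sum_subtractf flip: sum_divide_distrib)
  also have "\<dots> \<le> D_KL A b y u"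
    unfolding D_KL_eq
    by (intro sum_mono kl_lower less_le_trans[OF b affine_ge[OF A(1) u]] y)
  finally show ?thesis .
qed

text \<open>When \<open>\<gamma> = 0\<close> the data term alone must supply the curvature of the models.\<close>

lemma KL_form_coercive:
  fixes A :: "real^'n^'m"
  assumes y: "\<And>j. y $ j > 0" and inj: "\<And>u. A *v u = 0 \<Longrightarrow> u = 0" and "bounded S"
    and pos: "\<And>u j. u \<in> S \<Longrightarrow> (A *v u + b) $ j > 0"
  obtains c where "c > 0" "\<And>u d. u \<in> S \<Longrightarrow> c * (norm d)\<^sup>2 \<le> KL_form A b y u d"
proof -
  have "inj ((*v) A)"
    using inj by (simp add: linear_injective_0)
  then obtain B where B: "B > 0" "\<And>d. B * norm d \<le> norm (A *v d)"
    using linear_inj_bounded_below_pos[OF matrix_vector_mul_linear] by blast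
  have "bounded ((\<lambda>u. b + u) ` ((*v) A ` S))"
    using assms(3) by (intro bounded_translation bounded_linear_image) auto
  then obtain T where T: "T > 0" "\<And>u. u \<in> S \<Longrightarrow> norm (A *v u + b) \<le> T"
    unfolding bounded_pos by (auto simp: add.commute)
  define y0 where "y0 = Min (range (\<lambda>j. y $ j))"
  have y0: "y0 > 0" "\<And>j. y0 \<le> y $ j" unfolding y0_def using y by auto
  show ?thesis
  proof
    \<comment> \<open>\<open>y0 / T\<^sup>2\<close> bounds the coefficients of the form from below,
      since boundedness of \<open>S\<close> caps the denominators by \<open>T\<close>;
      \<open>B\<close> comes from injectivity of \<open>A\<close>.\<close>
    show "y0 / T\<^sup>2 * B\<^sup>2 > 0" using y0 T B by simp
    fix u d assume u: "u \<in> S"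
    have "(B * norm d)\<^sup>2 \<le> (norm (A *v d))\<^sup>2" using B by (intro power_mono) auto
    also have "\<dots> = (\<Sum>j\<in>UNIV. ((A *v d) $ j)\<^sup>2)"
      by (simp add: norm_vec_def L2_set_def sum_nonneg)
    finally have "y0 / T\<^sup>2 * B\<^sup>2 * (norm d)\<^sup>2 \<le> y0 / T\<^sup>2 * (\<Sum>j\<in>UNIV. ((A *v d) $ j)\<^sup>2)"
      using y0 T by (simp add: power_mult_distrib divide_right_mono)
    also have "\<dots> \<le> KL_form A b y u d"
      unfolding KL_form_def sum_distrib_left
    proof (rule sum_mono, rule mult_right_mono)
      fix j
      have "(A *v u + b) $ j \<le> T"
        using component_le_norm_cart[of "A *v u + b" j] T(2)[OF u] by linarith
      then show "y0 / T\<^sup>2 \<le> y $ j / ((A *v u + b) $ j)\<^sup>2"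
        using y0 pos[OF u, of j] y[of j]
        by (intro frac_le power_mono) (auto intro: less_imp_le)
    qed simp
    finally show "y0 / T\<^sup>2 * B\<^sup>2 * (norm d)\<^sup>2 \<le> KL_form A b y u d" .
  qed
qed

section \<open>Exact expansion of the models at the iterate, and assembly\<close>

lemma model_eq:
  fixes A :: "real^'n^'m"
  assumes pos: "\<And>j. (A *v u + b) $ j > 0" and y: "\<And>j. y $ j \<ge> 0"
  shows "model A b y D lam \<mu> \<gamma> u v = model A b y D lam \<mu> \<gamma> u u
    + (KL_grad A b y u + lam *\<^sub>R TV_grad D \<mu> u) \<bullet> (v - u)
    + (KL_form A b y u (v - u) + \<gamma> * (norm (v - u))\<^sup>2
       + lam * (\<Sum>i\<in>UNIV. TV_weight D \<mu> u i * (norm (D i *v (v - u)))\<^sup>2)) / 2"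
proof -
  have sq: "(norm (D i *v v))\<^sup>2 = (norm (D i *v u))\<^sup>2 + 2 * ((D i *v u) \<bullet> (D i *v (v - u)))
      + (norm (D i *v (v - u)))\<^sup>2" for i
    by (simp add: power2_norm_eq_inner matrix_vector_mult_diff_distrib algebra_simps inner_commute)
  have dist: "w * (p + 2 * q + r) = w * p + 2 * (w * q) + w * r" for w p q r :: real
    by (simp add: algebra_simps)
  have TV_eq: "(\<Sum>i\<in>UNIV. TV_weight D \<mu> u i * (norm (D i *v v))\<^sup>2)
      = (\<Sum>i\<in>UNIV. TV_weight D \<mu> u i * (norm (D i *v u))\<^sup>2) + 2 * (TV_grad D \<mu> u \<bullet> (v - u))
       + (\<Sum>i\<in>UNIV. TV_weight D \<mu> u i * (norm (D i *v (v - u)))\<^sup>2)"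
    by (simp only: inner_TV_grad sum.distrib sum_distrib_left sq dist)
  have KL_eq: "(v - u) \<bullet> ((hessian (D_KL A b y) u + \<gamma> *\<^sub>R mat 1) *v (v - u))
      = KL_form A b y u (v - u) + \<gamma> * (norm (v - u))\<^sup>2"
    using hessian_D_KL[OF pos y, of "v - u"]
    by (simp add: matrix_vector_mult_add_rdistrib scaleR_matrix_vector_assoc[symmetric]
        inner_add_right power2_norm_eq_inner)
  \<comment> \<open>The constant stays the model's own value at \<open>u\<close>: it can differ from
    the objective there, because on the quadratic branch of \<open>huber\<close> the weighted square
    and half of \<open>TV\<close> need not add up to \<open>TV\<close>. Only differences of model
    values are compared later.\<close>
  have "model A b y D lam \<mu> \<gamma> u u = D_KL A b y u
      + lam * (1 / 2 * (\<Sum>i\<in>UNIV. TV_weight D \<mu> u i * (norm (D i *v u))\<^sup>2) + 1 / 2 * TV D \<mu> u)"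
    by (simp add: model_def D_KL_model_def TV_model_def)
  \<comment> \<open>Stated for plain reals so that the large sums are regrouped as atoms.\<close>
  moreover have "a + G + 1 / 2 * K + lam * (1 / 2 * (p + 2 * q + r) + 1 / 2 * V)
      = a + lam * (1 / 2 * p + 1 / 2 * V) + (G + lam * q) + (K + lam * r) / 2" for a G K p q r V :: real
    by (simp add: field_simps)
  ultimately show ?thesis
    unfolding model_def[of A b y D lam \<mu> \<gamma> u v] D_KL_model_def TV_model_def TV_eq KL_eq
      gradient_eqI[OF GDERIV_D_KL[OF pos y]] inner_add_left inner_scaleR_left
      inner_commute[of "v - u" "KL_grad A b y u"]
    by (simp only:)
qed

lemma continuous_on_model: "continuous_on S (model A b y D lam \<mu> \<gamma> u)"
  unfolding model_def[abs_def] D_KL_model_def TV_model_def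
  by (intro continuous_intros matrix_vector_mult_linear_continuous_on
      continuous_on_compose2[OF matrix_vector_mult_linear_continuous_on]) auto

theorem theorem3:
  fixes A :: "real^'n^'m" and b y :: "real^'m"
    and r s :: nat and idx :: "'n \<Rightarrow> nat" and bc :: "nat \<Rightarrow> nat \<Rightarrow> real^'n \<Rightarrow> real"
    and D :: "'n \<Rightarrow> real^'n^2"
    and lam \<mu> \<gamma> \<eta> \<delta> :: real and \<epsilon> :: "nat \<Rightarrow> real"
    and S :: "(real^'n) set" and F :: "real^'n \<Rightarrow> real" and x :: "nat \<Rightarrow> real^'n"
  assumes idx: "bij_betw idx UNIV {1..r * s}"
    and bc: "\<And>k l. linear (bc k l)"
    and D: "D = diff_matrix r s idx bc"
    and A_nonneg: "\<And>i j. A $ i $ j \<ge> 0"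
    and A_sum: "\<And>j. (\<Sum>i\<in>UNIV. A $ i $ j) = 1"
    and b: "\<And>i. b $ i > 0"
    and y: "\<And>i. y $ i \<ge> 0"
    and lam: "lam > 0" and mu: "\<mu> > 0"
    and S: "S \<noteq> {}" "closed S" "convex S" "S \<subseteq> {u. \<forall>i. u $ i \<ge> 0}"
    and gam: "\<gamma> > 0 \<or>
      (\<gamma> = 0 \<and> (\<forall>i. y $ i > 0) \<and> (\<forall>u. A *v u = 0 \<longrightarrow> u = 0) \<and> bounded S)"
    and eta: "0 < \<eta>" "\<eta> < 1"
    and delta: "0 < \<delta>" "\<delta> < 1"
    and eps: "\<And>k. \<epsilon> k > 0" "\<epsilon> \<longlonglongrightarrow> 0"
    and F: "F = objective A b y D lam \<mu>"
    and x: "acquire_sequence F (model A b y D lam \<mu> \<gamma>) S \<eta> \<delta> \<epsilon> x"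
  shows "(\<exists>xbar\<in>S. (\<exists>\<sigma>. strict_mono \<sigma> \<and> (x \<circ> \<sigma>) \<longlonglongrightarrow> xbar) \<and> projected_gradient S F xbar = 0) \<and>
         (\<forall>xt. (\<exists>\<sigma>. strict_mono \<sigma> \<and> (x \<circ> \<sigma>) \<longlonglongrightarrow> xt) \<longrightarrow> projected_gradient S F xt = 0)"
proof -
  note orth = S(4)[THEN subsetD, simplified, rule_format]
  have ge: "(A *v u + b) $ j \<ge> b $ j" if "u \<in> S" for u j
    using affine_ge[OF A_nonneg orth[OF that]] .
  have pos: "(A *v u + b) $ j > 0" if "u \<in> S" for u j
    using ge[OF that, of j] b[of j] by linarith
  let ?g = "\<lambda>u. KL_grad A b y u + lam *\<^sub>R TV_grad D \<mu> u"
  let ?TQ = "\<lambda>u d. \<Sum>i\<in>UNIV. TV_weight D \<mu> u i * (norm (D i *v d))\<^sup>2"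
  let ?Q = "\<lambda>u d. KL_form A b y u d + \<gamma> * (norm d)\<^sup>2 + lam * ?TQ u d"
  let ?M = "KL_bound A b y + lam * TV_bound D \<mu>"
  let ?C = "\<Sum>j\<in>UNIV. y $ j * ln 2"
  have F_eq: "F = (\<lambda>u. D_KL A b y u + lam * TV D \<mu> u)"
    by (simp add: F objective_def fun_eq_iff)
  have grad: "gradient F u = ?g u" if "u \<in> S" for u
  proof (rule gradient_eqI)
    have "((\<lambda>u. D_KL A b y u + lam * TV D \<mu> u) has_derivative
        (\<lambda>d. d \<bullet> KL_grad A b y u + lam * (d \<bullet> TV_grad D \<mu> u))) (at u)"
      using GDERIV_D_KL[OF pos[OF that] y] GDERIV_TV[OF mu, of D u]
      unfolding gderiv_def by (intro has_derivative_add has_derivative_mult_right)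
    then show "GDERIV F u :> ?g u" unfolding gderiv_def F_eq by (simp add: inner_add_right)
  qed
  have cont: "continuous_on S ?g"
    using pos by (intro continuous_intros continuous_on_KL_grad continuous_on_TV_grad mu)
  have F_ge: "F u \<ge> norm u / 2 - ?C" if "u \<in> S" for u
    using D_KL_lower[OF A_nonneg A_sum b y orth[OF that]] TV_nonneg[OF mu, of D u] lam
    by (simp add: F_eq add_increasing2)
  have below: "F u \<ge> - ?C" if "u \<in> S" for u
    using F_ge[OF that] norm_ge_zero[of u] by linarith
  have level: "bounded {u \<in> S. F u \<le> C}" for C
    by (rule boundedI[of _ "2 * (C + ?C)"]) (use F_ge in force)
  \<comment> \<open>Adding 1 gives a strictly positive majorant constant even if \<open>?M\<close>
    is 0.\<close>
  have L: "?M + 1 > 0"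
    using KL_bound_nonneg[OF y, of A b] TV_bound_nonneg[OF mu, of D] lam
    by (simp add: add_nonneg_pos)
  have upper: "F v \<le> F u + ?g u \<bullet> (v - u) + (?M + 1) * (norm (v - u))\<^sup>2"
    if "u \<in> S" "v \<in> S" for u v
  proof -
    have "lam * TV D \<mu> v \<le> lam * (TV D \<mu> u + TV_grad D \<mu> u \<bullet> (v - u) + TV_bound D \<mu> * (norm (v - u))\<^sup>2)"
      using TV_upper[OF mu] lam by (intro mult_left_mono) auto
    moreover have "0 \<le> (norm (v - u))\<^sup>2" by simp
    ultimately show ?thesis
      using D_KL_upper[OF ge[OF that(1)] ge[OF that(2)] b y]
      unfolding F_eq inner_add_left inner_scaleR_left distrib_left distrib_right mult.assoc
      by linarith
  qed
  have TQ: "0 \<le> lam * ?TQ u d" "lam * ?TQ u d \<le> lam * TV_bound D \<mu> * (norm d)\<^sup>2" for u d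
    using TV_form_bounds[OF mu, of D u d] lam by (auto simp: mult.assoc)
  have Q_upper: "?Q u d \<le> (?M + \<gamma>) * (norm d)\<^sup>2" if "u \<in> S" for u d
    using KL_form_bounds(2)[OF ge[OF that] b y, of d] TQ(2)[of u d]
    by (simp add: algebra_simps)
  \<comment> \<open>Positive \<open>\<gamma>\<close> is itself a lower curvature bound, since the
    other two forms are nonnegative; for \<open>\<gamma> = 0\<close> the data term supplies
    it.\<close>
  obtain c where c: "c > 0" "\<And>u d. u \<in> S \<Longrightarrow> c * (norm d)\<^sup>2 \<le> ?Q u d"
  proof (cases "\<gamma> > 0")
    case True
    have "\<gamma> * (norm d)\<^sup>2 \<le> ?Q u d" if "u \<in> S" for u d
      using KL_form_bounds(1)[OF ge[OF that] b y, of d] TQ(1)[of u d] by simp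
    then show ?thesis using that True by blast
  next
    case False
    with gam have g0: "\<gamma> = 0" "\<And>i. y $ i > 0" "\<And>u. A *v u = 0 \<Longrightarrow> u = 0" "bounded S" by auto
    obtain c where c: "c > 0" "\<And>u d. u \<in> S \<Longrightarrow> c * (norm d)\<^sup>2 \<le> KL_form A b y u d"
      using KL_form_coercive[OF g0(2-4) pos] by blast
    have "c * (norm d)\<^sup>2 \<le> ?Q u d" if "u \<in> S" for u d
      using c(2)[OF that, of d] TQ(1)[of u d] g0(1) by simp
    then show ?thesis using that c(1) by blast
  qed
  \<comment> \<open>\<open>model_eq\<close> supplies the required expansion, with \<open>K u\<close>
    the model value at \<open>u\<close>. Stationarity of \<open>xbar\<close> is the second
    conclusion applied to the subsequence from the first.\<close>
  note conv = acquire_sequence_stationary[where g = ?g and Q = ?Q, OF S(2,3) grad cont below level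
      upper model_eq[OF pos y] continuous_on_model c(2) Q_upper c(1) L eta delta eps(2) x]
  show ?thesis using conv by blast
qed

end
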